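(* Let $f$ be meromorphic in the open unit disk $\mathbb{D}$. If $f^\#$ attains a local minimum at a point $z_0\in\mathbb{D}$, then $f^\#(z_0)=0$.
   Context: $\mathbb{D}=\{z\in\mathbb{C}:|z|<1\}$. The spherical derivative of a meromorphic function $f$ is $f^\#:=\frac{|f'|}{1+|f|^2}$, extended continuously to the poles of $f$ (equivalently, $f^\#(z_0)=(1/f)^\#(z_0)$ at a pole $z_0$). *)

theory Defs
  imports "HOL-Complex_Analysis.Complex_Analysis"
begin

(* At a pole the value is the continuous extension, i.e. the limit of the quotient over
   punctured neighbourhoods; whatever value f is assigned at the pole itself plays no role. *)
definition spherical_deriv :: "(complex \<Rightarrow> complex) \<Rightarrow> complex \<Rightarrow> real" where
  "spherical_deriv f z =
     (if is_pole f z
      then Lim (at z) (\<lambda>w. norm (deriv f w) / (1 + (norm (f w))\<^sup>2))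
      else norm (deriv f z) / (1 + (norm (f z))\<^sup>2))"

definition has_local_min_at :: "('a::topological_space \<Rightarrow> real) \<Rightarrow> 'a \<Rightarrow> bool" where
  "has_local_min_at g z \<longleftrightarrow> (\<forall>\<^sub>F w in nhds z. g z \<le> g w)"

end

theory Submission
  imports Defs
begin

text \<open>
  Where \<open>f'\<close> does not vanish, \<open>ln f\<^sup>#\<close> is strictly superharmonic, which already rules out a positive
  local minimum. The Laplacian can be avoided, because \<open>f\<^sup>#\<close> does not change under rotations of the
  Riemann sphere: composing \<open>f\<close> with a rotation that takes \<open>f z\<^sub>0\<close> to \<open>0\<close> yields a holomorphic \<open>g\<close>
  with \<open>g z\<^sub>0 = 0\<close> and \<open>g\<^sup># = f\<^sup>#\<close> near \<open>z\<^sub>0\<close>. If \<open>g' z\<^sub>0 \<noteq> 0\<close>, minimality at \<open>z\<^sub>0\<close> says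
  \<open>\<bar>g' z\<^sub>0\<bar> (1 + \<bar>g w\<bar>\<^sup>2) \<le> \<bar>g' w\<bar>\<close> for \<open>w\<close> near \<open>z\<^sub>0\<close>, so \<open>1 / g'\<close> is holomorphic and has a local
  maximum of its modulus. By the maximum modulus principle \<open>g'\<close> is constant; the same inequality then
  gives \<open>g = 0\<close>, contradicting \<open>g' z\<^sub>0 \<noteq> 0\<close>.

  At a finite value \<open>a = f z\<^sub>0\<close> the rotation is \<open>\<zeta> \<mapsto> (\<zeta> - a) / (1 + cnj a * \<zeta>)\<close>
  (\<open>spherical_deriv_rotate\<close>); at a pole it is the inversion \<open>\<zeta> \<mapsto> 1 / \<zeta>\<close>
  (\<open>spherical_deriv_inverse\<close>), and there it also identifies the limit that
  defines \<open>f\<^sup>#\<close> (\<open>spherical_deriv_pole\<close>).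
\<close>

lemma spherical_deriv_analytic:
  assumes "g analytic_on {z}"
  shows "spherical_deriv g z = norm (deriv g z) / (1 + (norm (g z))\<^sup>2)"
  using analytic_at_imp_no_pole[OF assms] by (simp add: spherical_deriv_def)

lemma has_local_min_at_cong:
  assumes "\<forall>\<^sub>F w in nhds z. g w = h w"
  shows "has_local_min_at g z \<longleftrightarrow> has_local_min_at h z"
proof -
  have "g z = h z"
    using assms by (rule eventually_nhds_x_imp_x)
  thus ?thesis
    unfolding has_local_min_at_def
    by (intro eventually_cong[OF assms]) auto
qed

text \<open>
  The normalisation \<open>g z = 0\<close> matters: it makes the factor \<open>1 + \<bar>g w\<bar>\<^sup>2\<close> smallest at \<open>z\<close>, so a
  minimum of the quotient there is a minimum of \<open>\<bar>g'\<bar>\<close>.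
\<close>
lemma deriv_eq_0_if_local_min_at_zero:
  assumes an: "g analytic_on {z}" and gz: "g z = 0"
    and min: "has_local_min_at (spherical_deriv g) z"
  shows "deriv g z = 0"
proof (rule ccontr)
  assume nz: "deriv g z \<noteq> 0"
  obtain e where e: "e > 0" "g holomorphic_on ball z e"
    using an analytic_at_ball by blast
  have "isCont (deriv g) z"
    using an by (intro analytic_at_imp_isCont analytic_intros)
  hence "\<forall>\<^sub>F w in nhds z. deriv g w \<noteq> 0"
    using continuous_at_avoid[of z "deriv g" 0] nz by (simp add: eventually_nhds_metric dist_commute)
  hence "\<forall>\<^sub>F w in nhds z. deriv g w \<noteq> 0 \<and> spherical_deriv g z \<le> spherical_deriv g w \<and> w \<in> ball z e"
    using min e(1) unfolding has_local_min_at_def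
    by (intro eventually_conj eventually_nhds_in_open) auto
  then obtain r where r: "r > 0" "\<And>w. w \<in> ball z r \<Longrightarrow>
      deriv g w \<noteq> 0 \<and> spherical_deriv g z \<le> spherical_deriv g w \<and> w \<in> ball z e"
    unfolding eventually_nhds_metric by (auto simp: dist_commute)
  have hol: "g holomorphic_on ball z r"
    using e(2) r(2) by (blast intro: holomorphic_on_subset)
  have le: "norm (deriv g z) * (1 + (norm (g w))\<^sup>2) \<le> norm (deriv g w)" if w: "w \<in> ball z r" for w
  proof -
    have "g analytic_on {w}"
      using hol w by (auto intro: holomorphic_on_imp_analytic_at)
    moreover have "1 + (norm (g w))\<^sup>2 > 0"
      by (simp add: add_pos_nonneg)
    ultimately show ?thesis
      using r(2)[OF w] by (simp add: spherical_deriv_analytic an gz field_simps)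
  qed
  have le': "norm (deriv g z) \<le> norm (deriv g w)" if w: "w \<in> ball z r" for w
  proof -
    have "norm (deriv g z) * 1 \<le> norm (deriv g z) * (1 + (norm (g w))\<^sup>2)"
      by (intro mult_left_mono) auto
    with le[OF w] show ?thesis by simp
  qed
  have "(\<lambda>w. inverse (deriv g w)) constant_on ball z r"
  proof (rule maximum_modulus_principle[where U = "ball z r" and \<xi> = z])
    show "(\<lambda>w. inverse (deriv g w)) holomorphic_on ball z r"
      using hol r(2) by (intro holomorphic_intros) auto
    show "norm (inverse (deriv g w)) \<le> norm (inverse (deriv g z))" if "w \<in> ball z r" for w
      using le'[OF that] nz by (simp add: norm_inverse le_imp_inverse_le)
  qed (use r(1) in auto)
  hence const: "deriv g w = deriv g z" if "w \<in> ball z r" for w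
    using that r(1) unfolding constant_on_def by (metis centre_in_ball inverse_inverse_eq)
  have "g w = 0" if w: "w \<in> ball z r" for w
  proof -
    have "norm (deriv g z) * (1 + (norm (g w))\<^sup>2) \<le> norm (deriv g z) * 1"
      using le[OF w] const[OF w] by simp
    hence "(norm (g w))\<^sup>2 \<le> 0"
      using nz by (subst (asm) mult_le_cancel_left_pos) auto
    thus ?thesis by simp
  qed
  hence "\<forall>\<^sub>F w in nhds z. g w = (\<lambda>_. 0) w"
    using r(1) by (intro eventually_nhds_metric[THEN iffD2]) (auto simp: dist_commute)
  hence "deriv g z = deriv (\<lambda>_. 0) z"
    by (intro deriv_cong_ev) auto
  with nz show False by simp
qed

text \<open>
  The map \<open>\<zeta> \<mapsto> (\<zeta> - a) / (1 + cnj a * \<zeta>)\<close> is a rotation of the sphere; concretely,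
  \<open>\<bar>1 + cnj a * \<zeta>\<bar>\<^sup>2 + \<bar>\<zeta> - a\<bar>\<^sup>2 = (1 + \<bar>a\<bar>\<^sup>2) (1 + \<bar>\<zeta>\<bar>\<^sup>2)\<close>, and \<open>1 + \<bar>a\<bar>\<^sup>2\<close> is also the numerator of
  the derivative of the map.
\<close>
lemma spherical_deriv_rotate:
  assumes an: "f analytic_on {z}" and nz: "1 + cnj a * f z \<noteq> 0"
  shows "spherical_deriv (\<lambda>w. (f w - a) / (1 + cnj a * f w)) z = spherical_deriv f z"
proof -
  define d where "d = 1 + cnj a * f z"
  have d: "d \<noteq> 0" using nz by (simp add: d_def)
  have an': "(\<lambda>w. (f w - a) / (1 + cnj a * f w)) analytic_on {z}"
    using an nz by (intro analytic_intros) auto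
  have "((\<lambda>w. (f w - a) / (1 + cnj a * f w)) has_field_derivative
      (deriv f z * d - (f z - a) * (cnj a * deriv f z)) / (d * d)) (at z)"
    unfolding d_def using nz
    by (auto intro!: derivative_eq_intros analytic_derivI an)
  moreover have "deriv f z * d - (f z - a) * (cnj a * deriv f z) = deriv f z * of_real (1 + (norm a)\<^sup>2)"
    unfolding d_def of_real_add complex_norm_square by (simp add: algebra_simps)
  ultimately have "deriv (\<lambda>w. (f w - a) / (1 + cnj a * f w)) z =
      deriv f z * of_real (1 + (norm a)\<^sup>2) / (d * d)"
    by (simp add: DERIV_imp_deriv)
  hence num: "norm (deriv (\<lambda>w. (f w - a) / (1 + cnj a * f w)) z) =
      norm (deriv f z) * (1 + (norm a)\<^sup>2) / (norm d)\<^sup>2"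
    by (simp only: norm_mult norm_divide norm_of_real) (simp add: power2_eq_square)
  have "complex_of_real ((norm d)\<^sup>2 + (norm (f z - a))\<^sup>2) =
      of_real ((1 + (norm a)\<^sup>2) * (1 + (norm (f z))\<^sup>2))"
    unfolding d_def of_real_add of_real_mult complex_norm_square
    by (simp add: algebra_simps)
  hence "(norm d)\<^sup>2 + (norm (f z - a))\<^sup>2 = (1 + (norm a)\<^sup>2) * (1 + (norm (f z))\<^sup>2)"
    by (simp only: of_real_eq_iff)
  hence den: "1 + (norm ((f z - a) / d))\<^sup>2 = (1 + (norm a)\<^sup>2) * (1 + (norm (f z))\<^sup>2) / (norm d)\<^sup>2"
    using d by (simp add: norm_divide power_divide field_simps)
  have pos: "1 + (norm a)\<^sup>2 \<noteq> 0" "1 + (norm (f z))\<^sup>2 \<noteq> 0"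
    by (simp_all add: add_nonneg_eq_0_iff)
  show ?thesis
    unfolding spherical_deriv_analytic[OF an'] spherical_deriv_analytic[OF an] num
    unfolding d_def[symmetric] den using d pos by simp
qed

lemma spherical_deriv_inverse:
  assumes an: "f analytic_on {z}" and nz: "f z \<noteq> 0"
  shows "spherical_deriv (\<lambda>w. inverse (f w)) z = spherical_deriv f z"
proof -
  have an': "(\<lambda>w. inverse (f w)) analytic_on {z}"
    using an nz by (intro analytic_intros) auto
  have "((\<lambda>w. inverse (f w)) has_field_derivative - deriv f z / (f z)\<^sup>2) (at z)"
    using nz by (auto intro!: derivative_eq_intros analytic_derivI an simp: field_simps power2_eq_square)
  hence num: "norm (deriv (\<lambda>w. inverse (f w)) z) = norm (deriv f z) / (norm (f z))\<^sup>2"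
    by (simp add: DERIV_imp_deriv norm_divide norm_power)
  have den: "1 + (norm (inverse (f z)))\<^sup>2 = (1 + (norm (f z))\<^sup>2) / (norm (f z))\<^sup>2"
    using nz by (simp add: norm_inverse add_divide_distrib power2_eq_square inverse_eq_divide norm_divide)
  show ?thesis
    unfolding spherical_deriv_analytic[OF an'] spherical_deriv_analytic[OF an] num den
    using nz by simp
qed

lemma spherical_deriv_eq_0_analytic:
  assumes an: "f analytic_on {z}" and min: "has_local_min_at (spherical_deriv f) z"
  shows "spherical_deriv f z = 0"
proof -
  define a where "a = f z"
  define g where "g = (\<lambda>w. (f w - a) / (1 + cnj a * f w))"
  have "1 + cnj a * f z = of_real (1 + (norm a)\<^sup>2)"
    unfolding a_def of_real_add complex_norm_square by simp
  moreover have "1 + (norm a)\<^sup>2 \<noteq> 0"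
    by (simp add: add_nonneg_eq_0_iff)
  ultimately have nz: "1 + cnj a * f z \<noteq> 0"
    by (metis of_real_eq_0_iff)
  have g: "g analytic_on {z}"
    unfolding g_def using an nz by (intro analytic_intros) auto
  have "isCont (\<lambda>w. 1 + cnj a * f w) z"
    using an by (intro analytic_at_imp_isCont analytic_intros)
  hence ev_nz: "\<forall>\<^sub>F w in nhds z. 1 + cnj a * f w \<noteq> 0"
    using continuous_at_avoid[of z "\<lambda>w. 1 + cnj a * f w" 0] nz
    by (simp add: eventually_nhds_metric dist_commute)
  obtain e where e: "e > 0" "f holomorphic_on ball z e"
    using an analytic_at_ball by blast
  have "\<forall>\<^sub>F w in nhds z. w \<in> ball z e"
    using e(1) by (intro eventually_nhds_in_open) auto
  with ev_nz have ev: "\<forall>\<^sub>F w in nhds z. spherical_deriv g w = spherical_deriv f w"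
  proof eventually_elim
    case (elim w)
    have "f analytic_on {w}"
      using e(2) elim(2) by (auto intro: holomorphic_on_imp_analytic_at)
    thus ?case
      unfolding g_def using elim(1) by (rule spherical_deriv_rotate)
  qed
  have gz: "g z = 0"
    by (simp add: g_def a_def)
  have "deriv g z = 0"
    using g gz min has_local_min_at_cong[OF ev] by (intro deriv_eq_0_if_local_min_at_zero) auto
  thus ?thesis
    using eventually_nhds_x_imp_x[OF ev] spherical_deriv_analytic[OF g] by simp
qed

text \<open>
  Near a pole, \<open>1 / f\<close> with its removable singularity filled in is a holomorphic function with the
  same spherical derivative, also at the pole itself because \<open>(1 / f)\<^sup>#\<close> is continuous there.
\<close>
lemma spherical_deriv_pole:
  assumes iso: "isolated_singularity_at f z" and pole: "is_pole f z"
  defines "g \<equiv> (\<lambda>w. if w = z then 0 else inverse (f w))"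
  shows "g analytic_on {z}" and "\<forall>\<^sub>F w in nhds z. spherical_deriv f w = spherical_deriv g w"
proof -
  have ev_nz: "\<forall>\<^sub>F w in at z. f w \<noteq> 0"
    using pole by (rule non_zero_neighbour_pole)
  have lim: "(\<lambda>w. inverse (f w)) \<midarrow>z\<rightarrow> 0"
    using pole tendsto_inverse_0 unfolding is_pole_def by (rule filterlim_compose[rotated])
  have "isolated_singularity_at (\<lambda>w. inverse (f w)) z"
    using iso pole by (intro singularity_intros) auto
  thus g: "g analytic_on {z}"
    unfolding g_def using lim by (rule removable_singularity')
  obtain r where r: "r > 0" "f analytic_on ball z r - {z}"
    using iso by (auto simp: isolated_singularity_at_def)
  have "\<forall>\<^sub>F w in at z. w \<in> ball z r - {z}"
    using r(1) by (intro eventually_at_in_open) auto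
  with ev_nz have ev: "\<forall>\<^sub>F w in at z. norm (deriv f w) / (1 + (norm (f w))\<^sup>2) = spherical_deriv g w
      \<and> spherical_deriv f w = spherical_deriv g w"
  proof eventually_elim
    case (elim w)
    have f: "f analytic_on {w}"
      using r(2) elim(2) by (auto intro: analytic_on_subset)
    have inv: "(\<lambda>w. inverse (f w)) analytic_on {w}"
      using f elim(1) by (intro analytic_intros) auto
    have "\<forall>\<^sub>F u in nhds w. u \<in> - {z}"
      using elim(2) by (intro eventually_nhds_in_open) auto
    hence eq: "\<forall>\<^sub>F u in nhds w. g u = inverse (f u)"
      by eventually_elim (auto simp: g_def)
    have "g analytic_on {w}"
      using inv analytic_at_cong[OF eq refl] by simp
    hence "spherical_deriv g w = spherical_deriv (\<lambda>w. inverse (f w)) w"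
      using inv deriv_cong_ev[OF eq refl] eventually_nhds_x_imp_x[OF eq]
      by (simp add: spherical_deriv_analytic)
    also have "\<dots> = spherical_deriv f w"
      using f elim(1) by (rule spherical_deriv_inverse)
    finally show ?case
      using f by (simp add: spherical_deriv_analytic)
  qed
  have "isCont g z" "isCont (deriv g) z"
    using g by (auto intro!: analytic_at_imp_isCont analytic_intros)
  hence "isCont (\<lambda>w. norm (deriv g w) / (1 + (norm (g w))\<^sup>2)) z"
    by (intro continuous_intros) (auto simp: add_nonneg_eq_0_iff)
  moreover have "\<forall>\<^sub>F w in at z. norm (deriv g w) / (1 + (norm (g w))\<^sup>2) = spherical_deriv g w"
  proof -
    obtain e where e: "e > 0" "g holomorphic_on ball z e"
      using g analytic_at_ball by blast
    have "\<forall>\<^sub>F w in at z. w \<in> ball z e"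
      using e(1) by (intro eventually_at_in_open') auto
    thus ?thesis
    proof eventually_elim
      case (elim w)
      have "g analytic_on {w}"
        using e(2) elim by (auto intro: holomorphic_on_imp_analytic_at)
      thus ?case by (simp add: spherical_deriv_analytic)
    qed
  qed
  ultimately have "spherical_deriv g \<midarrow>z\<rightarrow> spherical_deriv g z"
    unfolding isCont_def spherical_deriv_analytic[OF g] by (rule Lim_transform_eventually)
  hence "(\<lambda>w. norm (deriv f w) / (1 + (norm (f w))\<^sup>2)) \<midarrow>z\<rightarrow> spherical_deriv g z"
    by (rule Lim_transform_eventually) (use ev in eventually_elim, simp)
  hence "spherical_deriv f z = spherical_deriv g z"
    using pole by (simp add: spherical_deriv_def tendsto_Lim)
  thus "\<forall>\<^sub>F w in nhds z. spherical_deriv f w = spherical_deriv g w"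
    using ev unfolding eventually_nhds_conv_at by (auto elim: eventually_mono)
qed

theorem proposition4:
  fixes f :: "complex \<Rightarrow> complex" and z\<^sub>0 :: complex
  assumes "f nicely_meromorphic_on ball 0 1"
    and "z\<^sub>0 \<in> ball 0 1"
    and "has_local_min_at (spherical_deriv f) z\<^sub>0"
  shows "spherical_deriv f z\<^sub>0 = 0"
proof (cases "is_pole f z\<^sub>0")
  case False
  with assms(1,2) have "f analytic_on {z\<^sub>0}"
    by (rule nicely_meromorphic_on_imp_analytic_at)
  thus ?thesis
    using assms(3) by (rule spherical_deriv_eq_0_analytic)
next
  case True
  have "f meromorphic_on {z\<^sub>0}"
    using assms(1,2) by (auto simp: nicely_meromorphic_on_def intro: meromorphic_on_subset)
  hence iso: "isolated_singularity_at f z\<^sub>0"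
    by (rule meromorphic_on_isolated_singularity)
  define g where "g = (\<lambda>w. if w = z\<^sub>0 then 0 else inverse (f w))"
  have g: "g analytic_on {z\<^sub>0}"
    and ev: "\<forall>\<^sub>F w in nhds z\<^sub>0. spherical_deriv f w = spherical_deriv g w"
    using spherical_deriv_pole[OF iso True] by (simp_all add: g_def)
  have "spherical_deriv g z\<^sub>0 = 0"
    using g assms(3) has_local_min_at_cong[OF ev] by (intro spherical_deriv_eq_0_analytic) auto
  thus ?thesis
    using eventually_nhds_x_imp_x[OF ev] by simp
qed

end
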